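(* Let $n$ be a positive integer, let $r_1,\ldots,r_n$ be positive irrational real numbers such that the only integer solution to $x_1 r_1+x_2 r_2+\cdots+x_n r_n=0$ is $x_1=x_2=\cdots=x_n=0$, and let $P_n\subset\mathbb{R}$ be the set constructed from $r_1,\ldots,r_n$ as in the context. Then $|P_n-P_n|=|P_n|^{\log_2 3}$.
   Context: For $b\in\mathbb{R}$ and a finite set $A\subset\mathbb{R}$, write $b+A=\{b+a: a\in A\}$ and $A-A=\{a-a' : a,a'\in A\}$. Given $r_1,\ldots,r_n$, define sets $P_j\subset\mathbb{R}$ for $0\le j\le n$ by $P_0=\{1\}$ and $P_j=P_{j-1}\cup(r_j+P_{j-1})$ for $1\le j\le n$; the set $P_j$ consists of $2^j$ real numbers. *)

theory Defs
  imports Complex_Main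
begin

text \<open>
  On sets the library's infix minus is set-theoretic difference, so the difference set
  \<open>A - A\<close> of additive combinatorics gets a constant of its own. The translate
  \<open>b + A\<close> is written as the image \<open>(+) b ` A\<close>.
\<close>

definition diff_set :: "real set \<Rightarrow> real set" where
  "diff_set A = {a - a' | a a'. a \<in> A \<and> a' \<in> A}"

text \<open>The sequence \<open>r\<close> is indexed from 1; the value \<open>r 0\<close> is never used.\<close>

primrec P_set :: "(nat \<Rightarrow> real) \<Rightarrow> nat \<Rightarrow> real set" where
  "P_set r 0 = {1}"
| "P_set r (Suc j) = P_set r j \<union> (+) (r (Suc j)) ` P_set r j"

end

theory Submission
  imports Defs "HOL-Library.FuncSet"
begin

text \<open>
  Up to translation, \<open>P_n\<close> consists of the integer combinations of \<open>r_1, \<dots>, r_n\<close> with coefficients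
  in \<open>{0, 1}\<close>, and its difference set of those with coefficients in \<open>{-1, 0, 1}\<close>. By independence,
  distinct coefficient vectors give distinct reals, so the cardinalities are \<open>2^n\<close> and \<open>3^n\<close>.
\<close>

definition int_comb :: "(nat \<Rightarrow> real) \<Rightarrow> nat \<Rightarrow> (nat \<Rightarrow> int) \<Rightarrow> real" where
  "int_comb r n x = (\<Sum>i\<in>{1..n}. of_int (x i) * r i)"

lemma int_comb_0 [simp]: "int_comb r 0 x = 0"
  by (simp add: int_comb_def)

lemma int_comb_Suc: "int_comb r (Suc n) x = int_comb r n x + of_int (x (Suc n)) * r (Suc n)"
  by (simp add: int_comb_def)

lemma int_comb_diff: "int_comb r n (\<lambda>i. x i - y i) = int_comb r n x - int_comb r n y"
  by (simp add: int_comb_def sum_subtractf algebra_simps)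

lemma int_comb_cong:
  assumes "\<And>i. i \<in> {1..n} \<Longrightarrow> x i = y i"
  shows "int_comb r n x = int_comb r n y"
  unfolding int_comb_def by (rule sum.cong) (use assms in auto)

text \<open>Each choice between keeping and translating by \<open>r j\<close> is the coefficient 0
  or 1 of \<open>r j\<close>; the summand 1 is the starting element of \<open>P_set r 0\<close>.
  Coefficient vectors range over the non-extensional space \<open>Pi\<close>, so they can be updated
  and subtracted without restricting them again.\<close>

lemma P_set_eq_int_comb: "P_set r n = (\<lambda>x. 1 + int_comb r n x) ` ({1..n} \<rightarrow> {0, 1})"
proof (induction n)
  case 0
  show ?case by auto
next
  case (Suc n)
  \<comment> \<open>This serves both halves of the union: \<open>e = 0\<close> gives the
    untranslated copy and \<open>e = 1\<close> the copy shifted by \<open>r (Suc n)\<close>. The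
    witness overwrites the coefficient at \<open>Suc n\<close>, which the sum up to \<open>n\<close>
    does not see.\<close>
  have step: "a + (1 + int_comb r n x) \<in> (\<lambda>x. 1 + int_comb r (Suc n) x) ` ({1..Suc n} \<rightarrow> {0, 1})"
    if x: "x \<in> {1..n} \<rightarrow> {0, 1}" and e: "e \<in> {0, 1}" and a: "a = of_int e * r (Suc n)"
    for x e a
  proof (rule image_eqI[where x = "x(Suc n := e)"])
    have "int_comb r n (x(Suc n := e)) = int_comb r n x"
      by (rule int_comb_cong) auto
    then show "a + (1 + int_comb r n x) = 1 + int_comb r (Suc n) (x(Suc n := e))"
      by (simp add: int_comb_Suc a)
    show "x(Suc n := e) \<in> {1..Suc n} \<rightarrow> {0, 1}"
      using x e by (auto simp: Pi_iff)
  qed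
  show ?case
  proof (intro equalityI subsetI)
    fix p assume "p \<in> P_set r (Suc n)"
    then consider x where "x \<in> {1..n} \<rightarrow> {0, 1}" "p = 0 + (1 + int_comb r n x)"
      | x where "x \<in> {1..n} \<rightarrow> {0, 1}" "p = r (Suc n) + (1 + int_comb r n x)"
      unfolding P_set.simps Suc.IH by auto
    then show "p \<in> (\<lambda>x. 1 + int_comb r (Suc n) x) ` ({1..Suc n} \<rightarrow> {0, 1})"
    proof cases
      case 1
      then show ?thesis using step[of _ 0 0] by simp
    next
      case 2
      then show ?thesis using step[of _ 1 "r (Suc n)"] by simp
    qed
  next
    fix p assume "p \<in> (\<lambda>x. 1 + int_comb r (Suc n) x) ` ({1..Suc n} \<rightarrow> {0, 1})"
    then obtain x where x: "x \<in> {1..Suc n} \<rightarrow> {0, 1}" and p: "p = 1 + int_comb r (Suc n) x"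
      by blast
    have "1 + int_comb r n x \<in> P_set r n"
      unfolding Suc.IH using x by (intro imageI) auto
    moreover have "x (Suc n) = 0 \<or> x (Suc n) = 1"
      using x by (auto simp: Pi_iff)
    ultimately show "p \<in> P_set r (Suc n)"
      by (auto simp: p int_comb_Suc algebra_simps image_iff)
  qed
qed

text \<open>The common summand 1 cancels, and the differences of two elements of {0, 1} are exactly
  -1, 0 and 1, chosen independently in each coordinate.\<close>

lemma diff_set_P_set_eq_int_comb:
  "diff_set (P_set r n) = int_comb r n ` ({1..n} \<rightarrow> {-1, 0, 1})"
proof (intro equalityI subsetI)
  fix d assume "d \<in> diff_set (P_set r n)"
  then obtain x y where xy: "x \<in> {1..n} \<rightarrow> {0, 1}" "y \<in> {1..n} \<rightarrow> {0, 1}"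
    and d: "d = int_comb r n x - int_comb r n y"
    by (auto simp: diff_set_def P_set_eq_int_comb)
  have "(\<lambda>i. x i - y i) \<in> {1..n} \<rightarrow> {-1, 0, 1}"
  proof (rule Pi_I)
    fix i assume "i \<in> {1..n}"
    then have "x i \<in> {0, 1}" "y i \<in> {0, 1}"
      using xy by blast+
    then show "x i - y i \<in> {-1, 0, 1}"
      by auto
  qed
  then show "d \<in> int_comb r n ` ({1..n} \<rightarrow> {-1, 0, 1})"
    unfolding d int_comb_diff[symmetric] by (rule imageI)
next
  fix d assume "d \<in> int_comb r n ` ({1..n} \<rightarrow> {-1, 0, 1})"
  then obtain z where z: "z \<in> {1..n} \<rightarrow> {-1, 0, 1}" and d: "d = int_comb r n z"
    by blast
  \<comment> \<open>Positive and negative parts of \<open>z\<close>: their difference is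
    \<open>z\<close>, and both take values in {0, 1} on {1..n}.\<close>
  define x y where "x = (\<lambda>i. max (z i) 0)" and "y = (\<lambda>i. max (- z i) 0)"
  have "x \<in> {1..n} \<rightarrow> {0, 1}" "y \<in> {1..n} \<rightarrow> {0, 1}"
    using z by (force simp: x_def y_def Pi_iff)+
  moreover have "z = (\<lambda>i. x i - y i)"
    by (auto simp: x_def y_def)
  then have "d = (1 + int_comb r n x) - (1 + int_comb r n y)"
    by (simp add: d int_comb_diff)
  ultimately show "d \<in> diff_set (P_set r n)"
    unfolding diff_set_def P_set_eq_int_comb by blast
qed

text \<open>The digit set \<open>D\<close> is left arbitrary so that one count covers both {0, 1}
  and {-1, 0, 1}.\<close>

lemma card_int_comb_image:
  assumes indep: "\<And>x. int_comb r n x = 0 \<Longrightarrow> \<forall>i\<in>{1..n}. x i = 0"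
  shows "card (int_comb r n ` ({1..n} \<rightarrow> D)) = card D ^ n"
proof -
  \<comment> \<open>On \<open>Pi\<close> the map is not injective, since values outside {1..n} are
    free. Passing to extensional functions keeps the image and makes each coefficient vector
    unique.\<close>
  have "int_comb r n ` ({1..n} \<rightarrow> D) = int_comb r n ` ({1..n} \<rightarrow>\<^sub>E D)"
  proof (intro equalityI subsetI)
    fix s assume "s \<in> int_comb r n ` ({1..n} \<rightarrow> D)"
    then obtain x where x: "x \<in> {1..n} \<rightarrow> D" and s: "s = int_comb r n x"
      by blast
    have "s = int_comb r n (restrict x {1..n})"
      unfolding s by (rule int_comb_cong) simp
    with x show "s \<in> int_comb r n ` ({1..n} \<rightarrow>\<^sub>E D)"
      by (auto intro: image_eqI)
  qed (auto simp: PiE_def)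
  moreover have "inj_on (int_comb r n) ({1..n} \<rightarrow>\<^sub>E D)"
  proof (rule inj_onI)
    fix x y assume xy: "x \<in> {1..n} \<rightarrow>\<^sub>E D" "y \<in> {1..n} \<rightarrow>\<^sub>E D"
      and "int_comb r n x = int_comb r n y"
    \<comment> \<open>Two vectors with the same value differ by an integer relation among the
      \<open>r i\<close>, which independence forces to be trivial.\<close>
    then have "\<forall>i\<in>{1..n}. x i - y i = 0"
      by (intro indep) (simp add: int_comb_diff)
    then show "x = y"
      using xy by (intro PiE_ext) auto
  qed
  ultimately show ?thesis
    by (simp add: card_image card_PiE)
qed

theorem claim2p1:
  fixes n :: nat and r :: "nat \<Rightarrow> real"
  assumes n_pos: "n \<ge> 1"
    and r_pos: "\<And>i. i \<in> {1..n} \<Longrightarrow> r i > 0"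
    and r_irrational: "\<And>i. i \<in> {1..n} \<Longrightarrow> r i \<notin> \<rat>"
    and only_trivial_solution:
      "\<And>x :: nat \<Rightarrow> int. (\<Sum>i\<in>{1..n}. of_int (x i) * r i) = 0 \<Longrightarrow> (\<forall>i\<in>{1..n}. x i = 0)"
  shows "real (card (diff_set (P_set r n))) = real (card (P_set r n)) powr (log 2 3)"
proof -
  note card = card_int_comb_image[OF only_trivial_solution[folded int_comb_def], simplified]
  \<comment> \<open>Splitting off the translation by 1, which is injective, reduces the cardinality
    to that of the image under \<open>int_comb\<close>.\<close>
  have "P_set r n = (+) 1 ` int_comb r n ` ({1..n} \<rightarrow> {0, 1})"
    by (simp add: P_set_eq_int_comb image_image)
  then have "card (P_set r n) = 2 ^ n"
    by (simp add: card_image card numeral_2_eq_2)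
  moreover have "card (diff_set (P_set r n)) = 3 ^ n"
    by (simp add: diff_set_P_set_eq_int_comb card numeral_3_eq_3)
  \<comment> \<open>The two exponents are interchanged while \<open>log 2 3\<close> stays symbolic;
    \<open>powr_log_cancel\<close> would turn the base on the right into 3 too early, and is used
    only in the last step.\<close>
  moreover have "(2 ^ n :: real) powr log 2 3 = (2 powr log 2 3) ^ n"
    by (simp add: powr_realpow[symmetric] powr_powr powr_power mult.commute del: powr_log_cancel)
  ultimately show ?thesis
    by simp
qed

end
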